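(* Let $f_j\otimes\mathbf 1_S\in\mathcal A_{\bar i}$ be some $R_j$-local operator relative to frame $R_i$. Then $f_j\otimes\mathbf 1_S\in\mathcal A_{\bar i}^{X}$ for some bilocal unitary $X$ (and some orientations $g_i,g_j\in\mathcal G$) if and only if it lies in the image of $\hat\Pi_{\mathbf d}$, i.e. if and only if $f_j$ is diagonal in the frame orientation basis, $f_j=\sum_g f_g|g\rangle\langle g|_j$. In particular, $f_j\otimes\mathbf 1_S\in\mathcal A_{\bar i}^{\mathbf d}$ resides in exactly all those subalgebras $\mathcal A_{\bar i}^{X}$ with $X=Y_j\otimes Z_S$ such that $Z_S$ is an arbitrary $S$-unitary and the action of the $R_j$-unitary $Y_j$ on $f_j$ is equivalent to that of the (unitary) parity-swap operator $P_j^{g_i,g_j}=\sum_{g\in\mathcal G}|g_ig\rangle\langle g_jg^{-1}|_j$ in the form $$\hat Y_j^\dagger(f_j)=\hat P_j^{g_i,g_j}(f_j).$$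
   Context: $\mathcal G$ is a finite abelian group, $\mathcal G\neq\{e\}$. For $i=1,2$ (two ideal quantum reference frames $R_1,R_2$), $\mathcal H_i=\ell^2(\mathcal G)$ has orthonormal basis $\{|g\rangle_i\}_{g\in\mathcal G}$ (the frame orientation basis). $\mathcal H_S$ is a (possibly infinite-dimensional) complex Hilbert space carrying a unitary representation $g\mapsto U_S^g$ of $\mathcal G$. For $i\neq j$ in $\{1,2\}$, $\mathcal H_{\bar i}=\mathcal H_j\otimes\mathcal H_S$ (the description of $R_j$ and $S$ relative to $R_i$) and $\mathcal A_{\bar i}$ is the algebra of (bounded) linear operators on it. For a unitary $W$ write $\hat W(A)=WAW^\dagger$ and $\hat W^\dagger(A)=W^\dagger AW$. For $g_i,g_j\in\mathcal G$ define the unitary $\mathbf U_{\bar i}^{g_i,g_j}=\sum_{g\in\mathcal G}|g_ig\rangle\langle g_jg^{-1}|_j\otimes U_S^g$ on $\mathcal H_{\bar i}$. For a bilocal unitary $X=Y_j\otimes Z_S$ (with $Y_j$, $Z_S$ unitary on $\mathcal H_j$, $\mathcal H_S$), the TPS-invariant subalgebra is $$\mathcal A_{\bar i}^{X}=\{f\in\mathcal A_{\bar i}:\ \hat{\mathbf U}_{\bar i}^{g_i,g_j}(f)=\hat X^\dagger(f)\},$$ with the dependence on $g_i,g_j$ suppressed in the notation. $\hat\Pi_{\mathbf d}(f)=\sum_{g\in\mathcal G}(|g\rangle\langle g|_j\otimes\mathbf 1_S)f(|g\rangle\langle g|_j\otimes\mathbf 1_S)$ for $f\in\mathcal A_{\bar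 i}$, and $\mathcal A_{\bar i}^{\mathbf d}=\hat\Pi_{\mathbf d}(\mathcal A_{\bar i})$.
   Formalization: The first equivalence (in some A^X iff in the image of Π_d) is stated assuming no U_S^g with g≠e is a scalar multiple of the identity; without this it is false, e.g. for trivial U_S every f_j⊗1 lies in some A^X. H_S is taken nonzero. *)

theory Defs
  imports "HOL-Analysis.Analysis"
begin

section \<open>Complex Hilbert spaces\<close>

text \<open>
  The inner product is conjugate-linear in its first argument, as in Dirac notation.
\<close>

class chilbert_space = banach +
  fixes scaleC :: "complex \<Rightarrow> 'a \<Rightarrow> 'a" (infixr \<open>*\<^sub>C\<close> 75)
    and cinner :: "'a \<Rightarrow> 'a \<Rightarrow> complex"
  assumes scaleC_add_right: "c *\<^sub>C (x + y) = c *\<^sub>C x + c *\<^sub>C y"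
    and scaleC_add_left: "(c + d) *\<^sub>C x = c *\<^sub>C x + d *\<^sub>C x"
    and scaleC_scaleC [simp]: "c *\<^sub>C d *\<^sub>C x = (c * d) *\<^sub>C x"
    and scaleR_scaleC: "r *\<^sub>R x = complex_of_real r *\<^sub>C x"
    and cinner_commute: "cinner x y = cnj (cinner y x)"
    and cinner_add_right: "cinner x (y + z) = cinner x y + cinner x z"
    and cinner_scaleC_right [simp]: "cinner x (c *\<^sub>C y) = c * cinner x y"
    and cinner_same: "cinner x x = complex_of_real ((norm x)\<^sup>2)"

lemma scaleC_one [simp]: "1 *\<^sub>C x = (x::'a::chilbert_space)"
  using scaleR_scaleC[of 1 x] by simp

lemma scaleC_zero_left [simp]: "0 *\<^sub>C x = (0::'a::chilbert_space)"
  using scaleR_scaleC[of 0 x] by simp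

lemma scaleC_zero_right [simp]: "c *\<^sub>C 0 = (0::'a::chilbert_space)"
  using scaleC_add_right[of c 0 0] by simp

lemma cinner_zero_right [simp]: "cinner x 0 = 0"
  using cinner_add_right[of x 0 0] by simp

lemma cinner_zero_left [simp]: "cinner 0 x = 0"
  using cinner_commute[of 0 x] by simp

lemma cinner_add_left: "cinner (x + y) z = cinner x z + cinner y z"
  using cinner_commute[of "x + y" z] cinner_commute[of x z] cinner_commute[of y z]
  by (simp add: cinner_add_right)

lemma cinner_scaleC_left [simp]: "cinner (c *\<^sub>C x) y = cnj c * cinner x y"
  using cinner_commute[of "c *\<^sub>C x" y] cinner_commute[of x y] by simp

lemma cinner_minus_right: "cinner x (y - z) = cinner x y - cinner x z"
  using cinner_add_right[of x "y - z" z] by (simp add: algebra_simps)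

lemma cinner_ext:
  fixes x y :: "'a::chilbert_space"
  assumes "\<And>z. cinner z x = cinner z y"
  shows "x = y"
proof -
  have "cinner (x - y) (x - y) = 0"
    using assms by (simp add: cinner_minus_right)
  then show ?thesis
    by (simp add: cinner_same)
qed

instantiation complex :: chilbert_space
begin

definition scaleC_complex :: "complex \<Rightarrow> complex \<Rightarrow> complex"
  where [simp]: "scaleC_complex c x = c * x"

definition cinner_complex :: "complex \<Rightarrow> complex \<Rightarrow> complex"
  where [simp]: "cinner_complex x y = cnj x * y"

instance
proof
  fix x :: complex
  show "cinner x x = complex_of_real ((norm x)\<^sup>2)"
    by (simp only: cinner_complex_def complex_norm_square mult.commute)
qed (auto simp: algebra_simps scaleR_conv_of_real)

end

instantiation vec :: (chilbert_space, finite) chilbert_space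
begin

definition scaleC_vec :: "complex \<Rightarrow> 'a ^ 'b \<Rightarrow> 'a ^ 'b"
  where "scaleC_vec c x = (\<chi> i. c *\<^sub>C x $ i)"

definition cinner_vec :: "'a ^ 'b \<Rightarrow> 'a ^ 'b \<Rightarrow> complex"
  where "cinner_vec x y = (\<Sum>i\<in>UNIV. cinner (x $ i) (y $ i))"

instance
proof
  fix c d :: complex and r :: real and x y z :: "'a ^ 'b"
  show "c *\<^sub>C (x + y) = c *\<^sub>C x + c *\<^sub>C y"
    by (simp add: scaleC_vec_def vec_eq_iff scaleC_add_right)
  show "(c + d) *\<^sub>C x = c *\<^sub>C x + d *\<^sub>C x"
    by (simp add: scaleC_vec_def vec_eq_iff scaleC_add_left)
  show "c *\<^sub>C d *\<^sub>C x = (c * d) *\<^sub>C x"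
    by (simp add: scaleC_vec_def vec_eq_iff)
  show "r *\<^sub>R x = complex_of_real r *\<^sub>C x"
    by (simp add: scaleC_vec_def vec_eq_iff scaleR_scaleC)
  show "cinner x y = cnj (cinner y x)"
    unfolding cinner_vec_def cnj_sum by (intro sum.cong refl) (rule cinner_commute)
  show "cinner x (y + z) = cinner x y + cinner x z"
    by (simp add: cinner_vec_def cinner_add_right sum.distrib)
  show "cinner x (c *\<^sub>C y) = c * cinner x y"
    by (simp add: cinner_vec_def scaleC_vec_def sum_distrib_left)
  show "cinner x x = complex_of_real ((norm x)\<^sup>2)"
    by (simp add: cinner_vec_def cinner_same norm_vec_def L2_set_def sum_nonneg)
qed

end

lemma scaleC_vec_nth [simp]: "(c *\<^sub>C x) $ i = c *\<^sub>C (x $ i)"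
  by (simp add: scaleC_vec_def)

section \<open>Operators\<close>

definition bounded_clinear :: "('a::chilbert_space \<Rightarrow> 'b::chilbert_space) \<Rightarrow> bool"
  where "bounded_clinear A \<longleftrightarrow> bounded_linear A \<and> (\<forall>c x. A (c *\<^sub>C x) = c *\<^sub>C A x)"

definition cadjoint :: "('a::chilbert_space \<Rightarrow> 'a) \<Rightarrow> 'a \<Rightarrow> 'a"
  where "cadjoint A = (SOME B. \<forall>x y. cinner (A x) y = cinner x (B y))"

definition unitary :: "('a::chilbert_space \<Rightarrow> 'a) \<Rightarrow> bool"
  where "unitary W \<longleftrightarrow>
    bounded_clinear W \<and> surj W \<and> (\<forall>x y. cinner (W x) (W y) = cinner x y)"

text \<open>\<open>conj_by W A\<close> is \<open>W A W\<^sup>\<dagger>\<close> and \<open>conj_by_dag W A\<close> is \<open>W\<^sup>\<dagger> A W\<close>.\<close>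

definition conj_by :: "('a::chilbert_space \<Rightarrow> 'a) \<Rightarrow> ('a \<Rightarrow> 'a) \<Rightarrow> 'a \<Rightarrow> 'a"
  where "conj_by W A = W \<circ> A \<circ> cadjoint W"

definition conj_by_dag :: "('a::chilbert_space \<Rightarrow> 'a) \<Rightarrow> ('a \<Rightarrow> 'a) \<Rightarrow> 'a \<Rightarrow> 'a"
  where "conj_by_dag W A = cadjoint W \<circ> A \<circ> W"

definition unitary_rep :: "('g::ab_group_add \<Rightarrow> 's::chilbert_space \<Rightarrow> 's) \<Rightarrow> bool"
  where "unitary_rep U \<longleftrightarrow> (\<forall>g. unitary (U g)) \<and> (\<forall>g h. U (g + h) = U g \<circ> U h)"

lemma cadjoint_eqI:
  assumes "\<And>x y. cinner (A x) y = cinner x (B y)"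
  shows "cadjoint A = B"
proof -
  have "\<forall>x y. cinner (A x) y = cinner x (cadjoint A y)"
    unfolding cadjoint_def by (rule someI[of _ B]) (simp add: assms)
  then have "cinner z (cadjoint A y) = cinner z (B y)" for z y
    using assms by simp
  then show ?thesis
    by (auto intro: cinner_ext)
qed

lemma unitary_cadjoint:
  assumes "unitary W"
  shows "cadjoint W \<circ> W = id" "W \<circ> cadjoint W = id"
proof -
  have iso: "cinner (W x) (W y) = cinner x y" for x y
    using assms by (simp add: unitary_def)
  have surj: "surj W"
    using assms by (simp add: unitary_def)
  have inj: "inj W"
    
  proof (rule injI)
    fix x y assume "W x = W y"
    then have "cinner z x = cinner z y" for z
      using iso[of z x] iso[of z y] by simp
    then show "x = y" by (rule cinner_ext)
  qed
  have "cadjoint W = inv W"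
    
  proof (rule cadjoint_eqI)
    fix x y
    show "cinner (W x) y = cinner x (inv W y)"
      using iso[of x "inv W y"] by (simp add: surj_f_inv_f[OF surj])
  qed
  then show "cadjoint W \<circ> W = id" "W \<circ> cadjoint W = id"
    using inj surj by (simp_all add: surj_iff[symmetric])
qed

section \<open>The frame and the system\<close>

text \<open>
  The finite abelian group is written additively as a type \<open>'g\<close>: the products
  \<open>g\<^sub>i g\<close> and \<open>g\<^sub>j g\<^sup>-\<^sup>1\<close> become \<open>gi + g\<close> and \<open>gj - g\<close>.
  The frame Hilbert space is \<open>complex ^ 'g\<close>. As \<open>'g\<close> is finite, its tensor product with
  a Hilbert space \<open>'s\<close> is the space \<open>'s ^ 'g\<close> of \<open>'s\<close>-valued functions on \<open>'g\<close>, with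
  \<open>\<phi> \<otimes> \<psi>\<close> the function \<open>g \<mapsto> \<phi>(g) \<psi>\<close>; an operator \<open>A \<otimes> B\<close> is determined by
  \<open>|h\<rangle> \<otimes> \<psi> \<mapsto> A|h\<rangle> \<otimes> B \<psi>\<close>.
\<close>

definition ket :: "'g::finite \<Rightarrow> complex ^ 'g"
  where "ket g = axis g 1"

definition ketbra :: "'g::finite \<Rightarrow> 'g \<Rightarrow> complex ^ 'g \<Rightarrow> complex ^ 'g"
  where "ketbra g h \<phi> = cinner (ket h) \<phi> *\<^sub>C ket g"

definition tensor_vec :: "complex ^ 'g::finite \<Rightarrow> 's::chilbert_space \<Rightarrow> 's ^ 'g"
  where "tensor_vec \<phi> \<psi> = (\<chi> g. (\<phi> $ g) *\<^sub>C \<psi>)"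

definition tensor_op ::
    "(complex ^ 'g::finite \<Rightarrow> complex ^ 'g) \<Rightarrow> ('s::chilbert_space \<Rightarrow> 's) \<Rightarrow> 's ^ 'g \<Rightarrow> 's ^ 'g"
    (infixr \<open>\<otimes>\<^sub>o\<close> 70)
  where "(A \<otimes>\<^sub>o B) \<Psi> = (\<Sum>h\<in>UNIV. tensor_vec (A (ket h)) (B (\<Psi> $ h)))"

lemma ket_nth: "ket h $ g = (if g = h then 1 else 0)"
  by (auto simp: ket_def axis_def)

lemma cinner_ket [simp]: "cinner (ket h) \<phi> = \<phi> $ h"
proof -
  have "cinner (ket h $ g) (\<phi> $ g) = (if g = h then \<phi> $ g else 0)" for g
    by (simp add: ket_nth)
  then show ?thesis
    by (simp add: cinner_vec_def)
qed

lemma ket_expansion: "\<phi> = (\<Sum>h\<in>UNIV. (\<phi> $ h) *\<^sub>C ket h)"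
proof -
  have "((\<phi> $ h) *\<^sub>C ket h) $ g = (if g = h then \<phi> $ g else 0)" for g h
    by (simp add: ket_nth)
  then show ?thesis
    by (simp add: vec_eq_iff)
qed

lemma tensor_op_tensor_vec:
  assumes "bounded_clinear A" and "bounded_clinear B"
  shows "(A \<otimes>\<^sub>o B) (tensor_vec \<phi> \<psi>) = tensor_vec (A \<phi>) (B \<psi>)"
proof -
  have lin: "linear A" and sc: "A (c *\<^sub>C x) = c *\<^sub>C A x" "B (c *\<^sub>C y) = c *\<^sub>C B y" for c x y
    using assms by (auto simp: bounded_clinear_def bounded_linear.linear)
  have add: "(\<Sum>h\<in>S. c h *\<^sub>C B \<psi>) = (\<Sum>h\<in>S. c h) *\<^sub>C B \<psi>" for c and S :: "'a set"
    by (induction S rule: infinite_finite_induct) (auto simp: scaleC_add_left)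
  have "A \<phi> = A (\<Sum>h\<in>UNIV. (\<phi> $ h) *\<^sub>C ket h)"
    using ket_expansion[of \<phi>] by (rule arg_cong)
  also have "\<dots> = (\<Sum>h\<in>UNIV. (\<phi> $ h) *\<^sub>C A (ket h))"
    by (simp add: linear_sum[OF lin] sc)
  finally have "A \<phi> $ g = (\<Sum>h\<in>UNIV. A (ket h) $ g * \<phi> $ h)" for g
    by (simp add: mult.commute)
  then have "(\<Sum>h\<in>UNIV. (A (ket h) $ g * \<phi> $ h) *\<^sub>C B \<psi>) = (A \<phi> $ g) *\<^sub>C B \<psi>" for g
    by (simp only: add)
  then show ?thesis
    by (simp add: tensor_op_def tensor_vec_def vec_eq_iff sc)
qed

definition parity_swap ::
    "'g::{finite,ab_group_add} \<Rightarrow> 'g \<Rightarrow> (complex, 'g) vec \<Rightarrow> (complex, 'g) vec"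
  where "parity_swap gi gj \<phi> = (\<Sum>g\<in>UNIV. ketbra (gi + g) (gj - g) \<phi>)"

text \<open>\<open>frame_unitary U gi gj\<close> is the change-of-frame unitary for the representation
  \<open>U\<close> of the group on the system.\<close>

definition frame_unitary ::
    "('g::{finite,ab_group_add} \<Rightarrow> 's::chilbert_space \<Rightarrow> 's) \<Rightarrow> 'g \<Rightarrow> 'g \<Rightarrow> ('s, 'g) vec \<Rightarrow> ('s, 'g) vec"
  where "frame_unitary U gi gj \<Psi> = (\<Sum>g\<in>UNIV. (ketbra (gi + g) (gj - g) \<otimes>\<^sub>o U g) \<Psi>)"

lemma tensor_op_ketbra_nth:
  assumes "B 0 = 0"
  shows "(ketbra g h \<otimes>\<^sub>o B) \<Psi> $ a = (if a = g then B (\<Psi> $ h) else 0)"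
proof -
  have "tensor_vec (ketbra g h (ket k)) (B (\<Psi> $ k)) $ a =
      (if k = h then if a = g then B (\<Psi> $ h) else 0 else 0)" for k
    by (auto simp: tensor_vec_def ketbra_def ket_nth)
  then show ?thesis
    by (simp add: tensor_op_def)
qed

lemma parity_swap_nth: "parity_swap gi gj \<phi> $ a = \<phi> $ (gj + gi - a)"
proof -
  have "ketbra (gi + g) (gj - g) \<phi> $ a = (if g = a - gi then \<phi> $ (gj + gi - a) else 0)" for g
    by (auto simp: ketbra_def ket_nth algebra_simps)
  then show ?thesis
    by (simp add: parity_swap_def)
qed

lemma frame_unitary_nth:
  assumes "unitary_rep U"
  shows "frame_unitary U gi gj \<Psi> $ a = U (a - gi) (\<Psi> $ (gj + gi - a))"
proof -
  have zero: "U g 0 = 0" for g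
    using assms
    by (auto simp: unitary_rep_def unitary_def bounded_clinear_def
        dest!: spec[of _ g] linear_0[OF bounded_linear.linear])
  have "(ketbra (gi + g) (gj - g) \<otimes>\<^sub>o U g) \<Psi> $ a =
      (if g = a - gi then U (a - gi) (\<Psi> $ (gj + gi - a)) else 0)" for g
    by (auto simp: tensor_op_ketbra_nth[where B = "U g", OF zero] algebra_simps)
  then show ?thesis
    by (simp add: frame_unitary_def)
qed

lemma unitaryI:
  assumes "\<And>x y. W (x + y) = W x + W y" and "\<And>c x. W (c *\<^sub>C x) = c *\<^sub>C W x"
    and "surj W" and iso: "\<And>x y. cinner (W x) (W y) = cinner x y"
  shows "unitary W"
proof -
  have "norm (W x) = norm x" for x
  proof -
    have "complex_of_real ((norm (W x))\<^sup>2) = complex_of_real ((norm x)\<^sup>2)"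
      using iso[of x x] by (simp only: cinner_same)
    then have "(norm (W x))\<^sup>2 = (norm x)\<^sup>2"
      by (simp only: of_real_eq_iff)
    then show ?thesis
      by simp
  qed
  then have "bounded_linear W"
    using assms by (intro bounded_linear_intro[where K = 1]) (simp_all add: scaleR_scaleC)
  with assms show ?thesis
    by (simp add: unitary_def bounded_clinear_def)
qed

lemma unitary_parity_swap: "unitary (parity_swap gi gj)"
proof (rule unitaryI)
  show "surj (parity_swap gi gj)"
    by (rule surjI[of _ "\<lambda>\<phi>. parity_swap gi gj \<phi>"]) (simp add: vec_eq_iff parity_swap_nth)
  fix x y :: "(complex, 'a) vec"
  show "cinner (parity_swap gi gj x) (parity_swap gi gj y) = cinner x y"
    unfolding cinner_vec_def parity_swap_nth
    by (rule sum.reindex_bij_witness[of _ "\<lambda>a. gj + gi - a" "\<lambda>a. gj + gi - a"]) auto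
qed (simp_all add: vec_eq_iff parity_swap_nth)

lemma unitary_frame_unitary:
  assumes "unitary_rep U"
  shows "unitary (frame_unitary U gi gj)"
proof (rule unitaryI)
  have U: "bounded_linear (U g)" "U g (c *\<^sub>C x) = c *\<^sub>C U g x" "surj (U g)"
    "cinner (U g x) (U g y) = cinner x y" for g c x y
    using assms by (auto simp: unitary_rep_def unitary_def bounded_clinear_def)
  note nth = frame_unitary_nth[OF assms]
  show "surj (frame_unitary U gi gj)"
  proof (rule surjI)
    fix \<Psi>
    show "frame_unitary U gi gj (\<chi> b. inv (U (gj - b)) (\<Psi> $ (gj + gi - b))) = \<Psi>"
      by (simp add: vec_eq_iff nth surj_f_inv_f[OF U(3)] algebra_simps)
  qed
  fix c x y
  show "frame_unitary U gi gj (x + y) = frame_unitary U gi gj x + frame_unitary U gi gj y"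
    by (simp add: vec_eq_iff nth linear_add[OF bounded_linear.linear[OF U(1)]])
  show "frame_unitary U gi gj (c *\<^sub>C x) = c *\<^sub>C frame_unitary U gi gj x"
    by (simp add: vec_eq_iff nth U(2))
  show "cinner (frame_unitary U gi gj x) (frame_unitary U gi gj y) = cinner x y"
    unfolding cinner_vec_def nth U(4)
    by (rule sum.reindex_bij_witness[of _ "\<lambda>a. gj + gi - a" "\<lambda>a. gj + gi - a"]) auto
qed

definition invariant_subalgebra ::
    "('g::{finite,ab_group_add} \<Rightarrow> 's::chilbert_space \<Rightarrow> 's) \<Rightarrow> 'g \<Rightarrow> 'g \<Rightarrow>
      (('s, 'g) vec \<Rightarrow> ('s, 'g) vec) \<Rightarrow> (('s, 'g) vec \<Rightarrow> ('s, 'g) vec) set"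
  where "invariant_subalgebra U gi gj X =
    {f. bounded_clinear f \<and> conj_by (frame_unitary U gi gj) f = conj_by_dag X f}"

definition diagonal_projection ::
    "('s::chilbert_space ^ 'g::finite \<Rightarrow> 's ^ 'g) \<Rightarrow> 's ^ 'g \<Rightarrow> 's ^ 'g"
  where "diagonal_projection f \<Psi> =
    (\<Sum>g\<in>UNIV. (ketbra g g \<otimes>\<^sub>o id) (f ((ketbra g g \<otimes>\<^sub>o id) \<Psi>)))"

definition diagonal_subalgebra :: "('s::chilbert_space ^ 'g::finite \<Rightarrow> 's ^ 'g) set"
  where "diagonal_subalgebra = diagonal_projection ` {f. bounded_clinear f}"

text \<open>
  Without this condition non-diagonal operators also lie in invariant subalgebras: if \<open>U k\<close> is
  a scalar \<open>c\<close> for some \<open>k \<noteq> 0\<close>, then the frame unitary with orientations \<open>0\<close> and \<open>k\<close>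
  maps \<open>|0\<rangle>\<langle>k| \<otimes> 1\<close> to \<open>c |k\<rangle>\<langle>0| \<otimes> 1\<close>, and a frame-local
  unitary (exchanging \<open>|0\<rangle>\<close> and \<open>|k\<rangle>\<close> up to a phase) does the same.
\<close>

definition projectively_faithful :: "('g::ab_group_add \<Rightarrow> 's::chilbert_space \<Rightarrow> 's) \<Rightarrow> bool"
  where "projectively_faithful U \<longleftrightarrow> (\<forall>g. g \<noteq> 0 \<longrightarrow> \<not> (\<exists>c. \<forall>\<psi>. U g \<psi> = c *\<^sub>C \<psi>))"

end

theory Submission
  imports Defs
begin

text \<open>
  Write \<open>M a k\<close> for the matrix of \<open>f\<close> in the frame orientation basis and \<open>s = g\<^sub>i + g\<^sub>j\<close>.
  Conjugating \<open>f \<otimes> 1\<close> by the frame unitary gives the operator matrix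
  \<open>M (s - a) (s - k) U (a - k)\<close>, whereas conjugating by \<open>Y \<otimes> Z\<close> gives \<open>N a k 1\<close>, with \<open>N\<close> the
  matrix of \<open>Y\<^sup>\<dagger> f Y\<close>. If the two agree, an entry \<open>M (s - a) (s - k) \<noteq> 0\<close> off the diagonal
  would make \<open>U (a - k)\<close> a scalar; and for diagonal \<open>f\<close> every factor \<open>U (a - k)\<close> that counts is
  \<open>U 0 = 1\<close>, so that only the conjugation by the parity swap remains.
\<close>

section \<open>Linear and unitary operators\<close>

lemma bounded_clinear_scaleC: "bounded_clinear A \<Longrightarrow> A (c *\<^sub>C x) = c *\<^sub>C A x"
  by (simp add: bounded_clinear_def)

lemma bounded_clinear_zero: "bounded_clinear A \<Longrightarrow> A 0 = 0"
  by (simp add: bounded_clinear_def bounded_linear.linear linear_0)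

lemma bounded_clinear_sum: "bounded_clinear A \<Longrightarrow> A (sum x I) = (\<Sum>i\<in>I. A (x i))"
  by (simp add: bounded_clinear_def bounded_linear.linear linear_sum)

lemma bounded_clinear_id: "bounded_clinear id"
  by (simp add: bounded_clinear_def id_def)

lemma bounded_clinear_compose:
  "bounded_clinear A \<Longrightarrow> bounded_clinear B \<Longrightarrow> bounded_clinear (A \<circ> B)"
  by (auto simp: bounded_clinear_def o_def intro: bounded_linear_compose)

lemma unitary_bounded_clinear: "unitary W \<Longrightarrow> bounded_clinear W"
  by (simp add: unitary_def)

lemma unitary_id: "unitary id"
  by (simp add: unitary_def bounded_clinear_id)

lemma scaleC_sum_left: "(\<Sum>i\<in>I. c i) *\<^sub>C x = (\<Sum>i\<in>I. c i *\<^sub>C x)"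
  by (induction I rule: infinite_finite_induct) (auto simp: scaleC_add_left)

lemma scaleC_sum_right: "c *\<^sub>C (\<Sum>i\<in>I. x i) = (\<Sum>i\<in>I. c *\<^sub>C x i)"
  by (induction I rule: infinite_finite_induct) (auto simp: scaleC_add_right)

lemma cinner_sum_left: "cinner (\<Sum>i\<in>I. x i) y = (\<Sum>i\<in>I. cinner (x i) y)"
  by (induction I rule: infinite_finite_induct) (auto simp: cinner_add_left)

lemma cinner_sum_right: "cinner y (\<Sum>i\<in>I. x i) = (\<Sum>i\<in>I. cinner y (x i))"
  by (induction I rule: infinite_finite_induct) (auto simp: cinner_add_right)

text \<open>Pairing both sides with \<open>x\<close> leaves the factor \<open>cinner x x\<close>,
  which is nonzero. This is how scalar matrix entries are recovered from vector equations
  below.\<close>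

lemma scaleC_cancel_right:
  fixes x :: "'a::chilbert_space"
  assumes "x \<noteq> 0"
  shows "c *\<^sub>C x = d *\<^sub>C x \<longleftrightarrow> c = d"
proof
  assume "c *\<^sub>C x = d *\<^sub>C x"
  then have "c * cinner x x = d * cinner x x"
    using cinner_scaleC_right by metis
  then show "c = d"
    using assms by (simp add: cinner_same)
qed simp

lemma bounded_linear_scaleC: "bounded_linear (\<lambda>x::'a::chilbert_space. c *\<^sub>C x)"
proof (rule bounded_linear_intro[where K = "cmod c"])
  fix x y :: 'a and r :: real
  show "c *\<^sub>C (x + y) = c *\<^sub>C x + c *\<^sub>C y"
    by (rule scaleC_add_right)
  show "c *\<^sub>C r *\<^sub>R x = r *\<^sub>R c *\<^sub>C x"
    by (simp add: scaleR_scaleC mult.commute)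
  \<comment> \<open>The class axioms tie the norm directly only to real scalars, so the norm of a
    complex multiple is computed through the inner product.\<close>
  have "cinner (c *\<^sub>C x) (c *\<^sub>C x) = cnj c * c * cinner x x"
    by simp
  then have "complex_of_real ((norm (c *\<^sub>C x))\<^sup>2) = cnj c * c * complex_of_real ((norm x)\<^sup>2)"
    by (simp only: cinner_same)
  also have "cnj c * c = complex_of_real ((cmod c)\<^sup>2)"
    by (simp only: complex_norm_square mult.commute)
  also have "\<dots> * complex_of_real ((norm x)\<^sup>2) = complex_of_real ((cmod c * norm x)\<^sup>2)"
    by (simp add: power_mult_distrib)
  finally have "(norm (c *\<^sub>C x))\<^sup>2 = (cmod c * norm x)\<^sup>2"
    by (simp only: of_real_eq_iff)
  then show "norm (c *\<^sub>C x) \<le> norm x * cmod c"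
    by (simp add: mult.commute)
qed

text \<open>As \<open>cadjoint\<close> is a choice, its defining property needs an argument: replace
  \<open>y\<close> by \<open>W (cadjoint W y)\<close> and use that \<open>W\<close> preserves inner
  products.\<close>

lemma cinner_cadjoint:
  assumes "unitary W"
  shows "cinner (W x) y = cinner x (cadjoint W y)"
proof -
  have "W (cadjoint W y) = y"
    using unitary_cadjoint(2)[OF assms] by (simp add: fun_eq_iff)
  then show ?thesis
    using assms unfolding unitary_def by metis
qed

lemma unitary_cadjoint_unitary:
  assumes "unitary W"
  shows "unitary (cadjoint W)"
proof (rule unitaryI)
  note inv = unitary_cadjoint[OF assms, unfolded fun_eq_iff o_apply id_apply, rule_format]
  show "surj (cadjoint W)"
    by (rule surjI[of _ W]) (rule inv)
  fix c x y
  show "cadjoint W (x + y) = cadjoint W x + cadjoint W y"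
    by (rule cinner_ext) (simp add: cinner_add_right flip: cinner_cadjoint[OF assms])
  show "cadjoint W (c *\<^sub>C x) = c *\<^sub>C cadjoint W x"
    by (rule cinner_ext) (simp flip: cinner_cadjoint[OF assms])
  show "cinner (cadjoint W x) (cadjoint W y) = cinner x y"
    by (simp add: inv flip: cinner_cadjoint[OF assms])
qed

text \<open>A right inverse suffices, because \<open>cadjoint W\<close> is already a left inverse.
  Adjoints of concrete unitaries are found in this way.\<close>

lemma cadjoint_unique:
  assumes "unitary W" and "W \<circ> V = id"
  shows "cadjoint W = V"
proof -
  have "cadjoint W = cadjoint W \<circ> (W \<circ> V)"
    using assms(2) by simp
  then show ?thesis
    by (simp add: unitary_cadjoint(1)[OF assms(1)] flip: comp_assoc)
qed

section \<open>Matrix entries\<close>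

lemma apply_nth_ket_expansion:
  assumes "bounded_clinear A"
  shows "A \<phi> $ a = (\<Sum>k\<in>UNIV. A (ket k) $ a * \<phi> $ k)"
proof -
  have "A \<phi> = A (\<Sum>k\<in>UNIV. (\<phi> $ k) *\<^sub>C ket k)"
    using ket_expansion[of \<phi>] by (rule arg_cong)
  then show ?thesis
    by (simp add: bounded_clinear_sum[OF assms] bounded_clinear_scaleC[OF assms] mult.commute)
qed

lemma ext_ket_nth:
  fixes A B :: "complex ^ 'g::finite \<Rightarrow> complex ^ 'h::finite"
  assumes "bounded_clinear A" and "bounded_clinear B"
    and "\<And>a k. A (ket k) $ a = B (ket k) $ a"
  shows "A = B"
proof -
  have "A \<phi> $ a = B \<phi> $ a" for \<phi> a
    by (simp add: assms(3) apply_nth_ket_expansion[OF assms(1), of \<phi>]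
        apply_nth_ket_expansion[OF assms(2), of \<phi>])
  then show ?thesis
    by (simp add: fun_eq_iff vec_eq_iff)
qed

section \<open>Tensor products of operators\<close>

lemma tensor_op_nth: "(A \<otimes>\<^sub>o B) \<Psi> $ a = (\<Sum>k\<in>UNIV. (A (ket k) $ a) *\<^sub>C B (\<Psi> $ k))"
  by (simp add: tensor_op_def tensor_vec_def)

text \<open>The vector \<open>axis k \<psi>\<close> is the product of \<open>ket k\<close> and
  \<open>\<psi>\<close>, so it picks out column \<open>k\<close> of \<open>A\<close>.\<close>

lemma tensor_op_axis_nth:
  assumes "bounded_clinear B"
  shows "(A \<otimes>\<^sub>o B) (axis k \<psi>) $ a = (A (ket k) $ a) *\<^sub>C B \<psi>"
proof -
  have "(A (ket h) $ a) *\<^sub>C B (axis k \<psi> $ h) = (if h = k then (A (ket k) $ a) *\<^sub>C B \<psi> else 0)" for h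
    by (simp add: axis_def bounded_clinear_zero[OF assms])
  then show ?thesis
    by (simp add: tensor_op_nth)
qed

lemma bounded_clinear_tensor_op:
  fixes A :: "complex ^ 'g::finite \<Rightarrow> complex ^ 'g" and B :: "'s::chilbert_space \<Rightarrow> 's"
  assumes "bounded_clinear B"
  shows "bounded_clinear (A \<otimes>\<^sub>o B)"
  unfolding bounded_clinear_def
proof
  \<comment> \<open>A finite sum of coordinate projection, \<open>B\<close>, scaling by a matrix
    entry and coordinate embedding, each of them bounded linear.\<close>
  have eq: "(A \<otimes>\<^sub>o B) = (\<lambda>\<Psi>. \<Sum>a\<in>UNIV. axis a (\<Sum>k\<in>UNIV. (A (ket k) $ a) *\<^sub>C B (\<Psi> $ k)))"
    by (simp add: fun_eq_iff vec_eq_iff tensor_op_nth axis_def if_distrib cong: if_cong)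
  have axis: "bounded_linear (axis a :: 's \<Rightarrow> 's ^ 'g)" for a
  proof (rule bounded_linear_intro[where K = 1])
    fix x y :: 's and r :: real
    show "axis a (x + y) = axis a x + (axis a y :: 's ^ 'g)"
      by (simp add: vec_eq_iff axis_def)
    show "axis a (r *\<^sub>R x) = r *\<^sub>R (axis a x :: 's ^ 'g)"
      by (simp add: vec_eq_iff axis_def)
    have "(norm (axis a x $ i))\<^sup>2 = (if i = a then (norm x)\<^sup>2 else 0)" for i
      by (simp add: axis_def)
    then show "norm (axis a x :: 's ^ 'g) \<le> norm x * 1"
      by (simp add: norm_vec_def L2_set_def)
  qed
  have B: "bounded_linear B"
    using assms by (simp add: bounded_clinear_def)
  show "bounded_linear (A \<otimes>\<^sub>o B)"
    unfolding eq
    by (intro bounded_linear_sum bounded_linear_compose[OF axis]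
        bounded_linear_compose[OF bounded_linear_scaleC] bounded_linear_compose[OF B]
        bounded_linear_vec_nth)
  show "\<forall>c x. (A \<otimes>\<^sub>o B) (c *\<^sub>C x) = c *\<^sub>C (A \<otimes>\<^sub>o B) x"
    by (simp add: vec_eq_iff tensor_op_nth bounded_clinear_scaleC[OF assms] scaleC_sum_right
        mult.commute)
qed

text \<open>This is the product of matrices: the entries of \<open>C\<close> are scalars and pass
  through \<open>B\<close>, and the sum over the middle index is an entry of
  \<open>A \<circ> C\<close>.\<close>

lemma tensor_op_compose:
  assumes "bounded_clinear A" and "bounded_clinear B"
  shows "(A \<otimes>\<^sub>o B) \<circ> (C \<otimes>\<^sub>o D) = (A \<circ> C) \<otimes>\<^sub>o (B \<circ> D)"
proof -
  have "(A \<otimes>\<^sub>o B) ((C \<otimes>\<^sub>o D) \<Psi>) $ a = ((A \<circ> C) \<otimes>\<^sub>o (B \<circ> D)) \<Psi> $ a" for \<Psi> a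
  proof -
    have "(A \<otimes>\<^sub>o B) ((C \<otimes>\<^sub>o D) \<Psi>) $ a =
        (\<Sum>h\<in>UNIV. \<Sum>k\<in>UNIV. (A (ket h) $ a * C (ket k) $ h) *\<^sub>C B (D (\<Psi> $ k)))"
      by (simp add: tensor_op_nth bounded_clinear_sum[OF assms(2)]
          bounded_clinear_scaleC[OF assms(2)] scaleC_sum_right)
    also have "\<dots> = (\<Sum>k\<in>UNIV. (\<Sum>h\<in>UNIV. A (ket h) $ a * C (ket k) $ h) *\<^sub>C B (D (\<Psi> $ k)))"
      by (subst sum.swap) (simp add: scaleC_sum_left)
    finally show ?thesis
      by (simp add: tensor_op_nth apply_nth_ket_expansion[OF assms(1), of "C _"])
  qed
  then show ?thesis
    by (simp add: fun_eq_iff vec_eq_iff)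
qed

text \<open>Evaluating on \<open>axis k \<psi>\<close> with \<open>\<psi> \<noteq> 0\<close> and
  cancelling \<open>\<psi>\<close> recovers every matrix entry.\<close>

lemma tensor_op_id_eq_iff:
  assumes "bounded_clinear A" and "bounded_clinear B" and "\<exists>\<psi>::'s::chilbert_space. \<psi> \<noteq> 0"
  shows "A \<otimes>\<^sub>o (id :: 's \<Rightarrow> 's) = B \<otimes>\<^sub>o id \<longleftrightarrow> A = B"
proof
  assume eq: "A \<otimes>\<^sub>o (id :: 's \<Rightarrow> 's) = B \<otimes>\<^sub>o id"
  obtain \<psi> :: 's where "\<psi> \<noteq> 0"
    using assms(3) by blast
  moreover have "(A (ket k) $ a) *\<^sub>C \<psi> = (B (ket k) $ a) *\<^sub>C \<psi>" for a k
    using tensor_op_axis_nth[OF bounded_clinear_id, of A k \<psi> a]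
      tensor_op_axis_nth[OF bounded_clinear_id, of B k \<psi> a] eq by simp
  ultimately show "A = B"
    using assms by (intro ext_ket_nth) (simp_all add: scaleC_cancel_right)
qed simp

text \<open>The matrix of \<open>cadjoint Y\<close> is the conjugate transpose of that of
  \<open>Y\<close>; exchanging the two index sums moves both factors to the other side of the inner
  product.\<close>

lemma cadjoint_tensor_op:
  assumes "unitary Y" and "unitary Z"
  shows "cadjoint (Y \<otimes>\<^sub>o Z) = cadjoint Y \<otimes>\<^sub>o cadjoint Z"
proof (rule cadjoint_eqI)
  fix \<Psi> \<Phi>
  have "cadjoint Y (ket a) $ k = cnj (Y (ket k) $ a)" for a k
  proof -
    have "cadjoint Y (ket a) $ k = cinner (Y (ket k)) (ket a)"
      by (simp add: cinner_cadjoint[OF assms(1)])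
    also have "\<dots> = cnj (cinner (ket a) (Y (ket k)))"
      by (rule cinner_commute)
    finally show ?thesis
      by simp
  qed
  then show "cinner ((Y \<otimes>\<^sub>o Z) \<Psi>) \<Phi> = cinner \<Psi> ((cadjoint Y \<otimes>\<^sub>o cadjoint Z) \<Phi>)"
    unfolding cinner_vec_def tensor_op_nth cinner_sum_left cinner_sum_right
    by (subst sum.swap) (simp add: cinner_cadjoint[OF assms(2)])
qed

lemma bounded_clinear_conj_by_dag:
  "unitary W \<Longrightarrow> bounded_clinear A \<Longrightarrow> bounded_clinear (conj_by_dag W A)"
  unfolding conj_by_dag_def
  by (simp add: bounded_clinear_compose unitary_bounded_clinear unitary_cadjoint_unitary)

lemma bounded_clinear_conj_by:
  "unitary W \<Longrightarrow> bounded_clinear A \<Longrightarrow> bounded_clinear (conj_by W A)"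
  unfolding conj_by_def
  by (simp add: bounded_clinear_compose unitary_bounded_clinear unitary_cadjoint_unitary)

text \<open>On the system factor only \<open>cadjoint Z \<circ> Z = id\<close> remains, which is why
  \<open>Z\<close> can be arbitrary.\<close>

lemma conj_by_dag_tensor_op_id:
  assumes "unitary Y" and "unitary Z" and "bounded_clinear f"
  shows "conj_by_dag (Y \<otimes>\<^sub>o Z) (f \<otimes>\<^sub>o id) = conj_by_dag Y f \<otimes>\<^sub>o id"
proof -
  have lin: "bounded_clinear (cadjoint Y)" "bounded_clinear (cadjoint Z)"
    by (simp_all add: assms unitary_bounded_clinear unitary_cadjoint_unitary)
  show ?thesis
    by (simp add: conj_by_dag_def cadjoint_tensor_op[OF assms(1,2)] tensor_op_compose lin
        bounded_clinear_compose assms(3) unitary_cadjoint(1)[OF assms(2)])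
qed

section \<open>The change of frame\<close>

lemma unitary_rep_add: "unitary_rep U \<Longrightarrow> U g (U h \<psi>) = U (g + h) \<psi>"
  by (simp add: unitary_rep_def)

text \<open>\<open>U 0\<close> is idempotent and surjective, hence the identity.\<close>

lemma unitary_rep_zero:
  assumes "unitary_rep U"
  shows "U 0 \<psi> = \<psi>"
proof -
  obtain \<phi> where "\<psi> = U 0 \<phi>"
    using assms by (metis unitary_rep_def unitary_def surjD)
  moreover have "U 0 (U 0 \<phi>) = U 0 \<phi>"
    using unitary_rep_add[OF assms, of 0 0] by simp
  ultimately show ?thesis
    by simp
qed

lemma unitary_rep_bounded_clinear: "unitary_rep U \<Longrightarrow> bounded_clinear (U g)"
  by (simp add: unitary_rep_def unitary_bounded_clinear)

text \<open>Exchanging the orientations inverts the change of frame: the reflection of the index is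
  undone, and the factors \<open>U (a - gi)\<close> and \<open>U (gi - a)\<close> cancel.\<close>

lemma cadjoint_frame_unitary:
  assumes "unitary_rep U"
  shows "cadjoint (frame_unitary U gi gj) = frame_unitary U gj gi"
proof (rule cadjoint_unique[OF unitary_frame_unitary[OF assms]])
  show "frame_unitary U gi gj \<circ> frame_unitary U gj gi = id"
    by (simp add: fun_eq_iff vec_eq_iff frame_unitary_nth[OF assms] unitary_rep_add[OF assms]
        unitary_rep_zero[OF assms])
qed

lemma cadjoint_parity_swap: "cadjoint (parity_swap gi gj) = parity_swap gi gj"
  by (rule cadjoint_unique[OF unitary_parity_swap])
    (simp add: fun_eq_iff vec_eq_iff parity_swap_nth)

lemma conj_by_frame_unitary_nth:
  assumes "unitary_rep U"
  shows "conj_by (frame_unitary U gi gj) (f \<otimes>\<^sub>o id) \<Psi> $ a =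
    (\<Sum>k\<in>UNIV. (f (ket (gj + gi - k)) $ (gj + gi - a)) *\<^sub>C U (a - k) (\<Psi> $ k))"
proof -
  note lin = unitary_rep_bounded_clinear[OF assms]
  have "conj_by (frame_unitary U gi gj) (f \<otimes>\<^sub>o id) \<Psi> $ a =
      (\<Sum>h\<in>UNIV. (f (ket h) $ (gj + gi - a)) *\<^sub>C U (a - gi) (U (h - gj) (\<Psi> $ (gi + gj - h))))"
    by (simp add: conj_by_def cadjoint_frame_unitary[OF assms] frame_unitary_nth[OF assms]
        tensor_op_nth bounded_clinear_sum[OF lin] bounded_clinear_scaleC[OF lin])
  \<comment> \<open>Substitute \<open>h = gj + gi - k\<close>; then \<open>U (a - gi)\<close> and
    \<open>U (gi - k)\<close> combine to \<open>U (a - k)\<close>, so the orientations enter only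
    through their sum.\<close>
  also have "\<dots> = (\<Sum>k\<in>UNIV. (f (ket (gj + gi - k)) $ (gj + gi - a)) *\<^sub>C U (a - k) (\<Psi> $ k))"
    by (rule sum.reindex_bij_witness[of _ "\<lambda>k. gj + gi - k" "\<lambda>k. gj + gi - k"])
      (auto simp: unitary_rep_add[OF assms] algebra_simps)
  finally show ?thesis .
qed

text \<open>The parity swap permutes the basis by the reflection
  \<open>k \<mapsto> gj + gi - k\<close>, which yields exactly the scalar coefficients found for the
  frame unitary.\<close>

lemma conj_by_parity_swap_ket_nth:
  "conj_by (parity_swap gi gj) f (ket k) $ a = f (ket (gj + gi - k)) $ (gj + gi - a)"
proof -
  have "parity_swap gi gj (ket k) = ket (gj + gi - k)"
    by (auto simp: vec_eq_iff parity_swap_nth ket_nth algebra_simps)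
  then show ?thesis
    by (simp add: conj_by_def cadjoint_parity_swap parity_swap_nth)
qed

lemma conj_by_frame_unitary_diagonal:
  assumes "unitary_rep U" and "bounded_clinear f" and diag: "\<And>a k. a \<noteq> k \<Longrightarrow> f (ket k) $ a = 0"
  shows "conj_by (frame_unitary U gi gj) (f \<otimes>\<^sub>o id) = conj_by (parity_swap gi gj) f \<otimes>\<^sub>o id"
proof -
  have "(f (ket (gj + gi - k)) $ (gj + gi - a)) *\<^sub>C U (a - k) \<psi> =
      (f (ket (gj + gi - k)) $ (gj + gi - a)) *\<^sub>C \<psi>" for a k \<psi>
    by (cases "a = k") (simp_all add: diag unitary_rep_zero[OF assms(1)])
  then show ?thesis
    by (simp add: fun_eq_iff vec_eq_iff conj_by_frame_unitary_nth[OF assms(1)] tensor_op_nth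
        conj_by_parity_swap_ket_nth)
qed

lemma invariant_imp_diagonal:
  assumes "unitary_rep U" and "bounded_clinear f" and "projectively_faithful U"
    and "unitary Y" and "unitary Z" and inv: "f \<otimes>\<^sub>o id \<in> invariant_subalgebra U gi gj (Y \<otimes>\<^sub>o Z)"
    and "b \<noteq> h"
  shows "f (ket h) $ b = 0"
proof (rule ccontr)
  \<comment> \<open>The reflection moves entry \<open>(b, h)\<close> of \<open>f\<close> to the
    position at which \<open>n\<close> is read off, where it is accompanied by
    \<open>U (h - b)\<close>.\<close>
  define m n where "m = f (ket h) $ b"
    and "n = conj_by_dag Y f (ket (gj + gi - h)) $ (gj + gi - b)"
  assume "f (ket h) $ b \<noteq> 0"
  then have "m \<noteq> 0"
    by (simp add: m_def)
  have eq: "conj_by (frame_unitary U gi gj) (f \<otimes>\<^sub>o id) = conj_by_dag Y f \<otimes>\<^sub>o id"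
    using inv by (simp add: invariant_subalgebra_def conj_by_dag_tensor_op_id assms)
  have "m *\<^sub>C U (h - b) \<psi> = n *\<^sub>C \<psi>" for \<psi>
  proof -
    \<comment> \<open>A vector supported at \<open>gj + gi - h\<close> isolates a single column of
      the operator matrix.\<close>
    have "(f (ket (gj + gi - k)) $ b) *\<^sub>C U (gj + gi - b - k) (axis (gj + gi - h) \<psi> $ k) =
        (if k = gj + gi - h then m *\<^sub>C U (h - b) \<psi> else 0)" for k
      by (auto simp: m_def axis_def bounded_clinear_zero[OF unitary_rep_bounded_clinear[OF assms(1)]])
    then have "conj_by (frame_unitary U gi gj) (f \<otimes>\<^sub>o id) (axis (gj + gi - h) \<psi>) $ (gj + gi - b) =
        m *\<^sub>C U (h - b) \<psi>"
      by (simp add: conj_by_frame_unitary_nth[OF assms(1)])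
    then show ?thesis
      by (simp add: eq tensor_op_axis_nth bounded_clinear_id n_def)
  qed
  then have "(1 / m) *\<^sub>C m *\<^sub>C U (h - b) \<psi> = (1 / m) *\<^sub>C n *\<^sub>C \<psi>" for \<psi>
    by (simp only:)
  then have "U (h - b) \<psi> = (n / m) *\<^sub>C \<psi>" for \<psi>
    using \<open>m \<noteq> 0\<close> by simp
  \<comment> \<open>Here \<open>h - b\<close> is nonzero, so \<open>U (h - b)\<close> cannot be the
    scalar \<open>n / m\<close>.\<close>
  then show False
    using assms(3) \<open>b \<noteq> h\<close> unfolding projectively_faithful_def by (metis eq_iff_diff_eq_0)
qed

text \<open>Both conjugates of the operator have the form of a frame operator tensored with
  \<open>id\<close>, so comparing them reduces to comparing the frame factors.\<close>

lemma diagonal_imp_invariant_iff: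
  fixes U :: "'g::{finite,ab_group_add} \<Rightarrow> 's::chilbert_space \<Rightarrow> 's"
  assumes "unitary_rep U" and "bounded_clinear f" and "\<exists>\<psi>::'s. \<psi> \<noteq> 0"
    and "\<And>a k. a \<noteq> k \<Longrightarrow> f (ket k) $ a = 0"
    and "unitary Y" and "unitary Z"
  shows "f \<otimes>\<^sub>o id \<in> invariant_subalgebra U gi gj (Y \<otimes>\<^sub>o Z) \<longleftrightarrow>
    conj_by_dag Y f = conj_by (parity_swap gi gj) f"
proof -
  note lin = bounded_clinear_conj_by[OF unitary_parity_swap assms(2)]
    bounded_clinear_conj_by_dag[OF assms(5,2)]
  have frame: "conj_by (frame_unitary U gi gj) (f \<otimes>\<^sub>o id) = conj_by (parity_swap gi gj) f \<otimes>\<^sub>o id"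
    using assms by (intro conj_by_frame_unitary_diagonal)
  show ?thesis
    unfolding invariant_subalgebra_def mem_Collect_eq conj_by_dag_tensor_op_id[OF assms(5,6,2)]
      frame tensor_op_id_eq_iff[OF lin assms(3)]
    using bounded_clinear_tensor_op[OF bounded_clinear_id[where 'a = 's], of f]
    by metis
qed

section \<open>Diagonal operators\<close>

text \<open>The projector for \<open>g\<close> keeps only component \<open>g\<close>, so of the
  blocks of \<open>A\<close> exactly the diagonal ones survive.\<close>

lemma diagonal_projection_nth:
  assumes "bounded_clinear A"
  shows "diagonal_projection A \<Psi> $ a = A (axis a (\<Psi> $ a)) $ a"
proof -
  have "(ketbra g g \<otimes>\<^sub>o id) \<Psi> = axis g (\<Psi> $ g)" for g
    by (simp add: vec_eq_iff tensor_op_ketbra_nth axis_def)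
  then show ?thesis
    by (simp add: diagonal_projection_def tensor_op_ketbra_nth)
qed

lemma diagonal_subalgebra_iff:
  assumes "bounded_clinear f" and "\<exists>\<psi>::'s::chilbert_space. \<psi> \<noteq> 0"
  shows "f \<otimes>\<^sub>o (id :: 's \<Rightarrow> 's) \<in> diagonal_subalgebra \<longleftrightarrow> (\<forall>a k. a \<noteq> k \<longrightarrow> f (ket k) $ a = 0)"
proof
  assume "f \<otimes>\<^sub>o (id :: 's \<Rightarrow> 's) \<in> diagonal_subalgebra"
  then obtain A where A: "bounded_clinear A" "f \<otimes>\<^sub>o (id :: 's \<Rightarrow> 's) = diagonal_projection A"
    by (auto simp: diagonal_subalgebra_def)
  obtain \<psi> :: 's where "\<psi> \<noteq> 0"
    using assms(2) by blast
  show "\<forall>a k. a \<noteq> k \<longrightarrow> f (ket k) $ a = 0"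
  proof (intro allI impI)
    fix a k :: 'a
    assume "a \<noteq> k"
    have "(f (ket k) $ a) *\<^sub>C \<psi> = (f \<otimes>\<^sub>o id) (axis k \<psi>) $ a"
      by (simp add: tensor_op_axis_nth bounded_clinear_id)
    \<comment> \<open>Component \<open>a\<close> of \<open>axis k \<psi>\<close> vanishes, so the
      diagonal block of \<open>A\<close> acts on zero.\<close>
    also have "\<dots> = A (axis a 0) $ a"
      using \<open>a \<noteq> k\<close> by (simp add: A diagonal_projection_nth) (simp add: axis_def)
    also have "axis a 0 = (0 :: 's ^ 'a)"
      by (simp add: vec_eq_iff axis_def)
    finally show "f (ket k) $ a = 0"
      using \<open>\<psi> \<noteq> 0\<close> scaleC_cancel_right[of \<psi> "f (ket k) $ a" 0]
      by (simp add: bounded_clinear_zero[OF A(1)])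
  qed
next
  assume diag: "\<forall>a k. a \<noteq> k \<longrightarrow> f (ket k) $ a = 0"
  have lin: "bounded_clinear (f \<otimes>\<^sub>o (id :: 's \<Rightarrow> 's))"
    by (simp add: bounded_clinear_tensor_op bounded_clinear_id)
  \<comment> \<open>A diagonal operator is fixed by the projection, so it serves as its own
    preimage.\<close>
  have "(f \<otimes>\<^sub>o (id :: 's \<Rightarrow> 's)) \<Psi> $ a = diagonal_projection (f \<otimes>\<^sub>o id) \<Psi> $ a" for \<Psi> a
  proof -
    have "(\<Sum>k\<in>UNIV. (f (ket k) $ a) *\<^sub>C \<Psi> $ k) =
        (\<Sum>k\<in>UNIV. if k = a then (f (ket a) $ a) *\<^sub>C \<Psi> $ a else 0)"
      using diag by (intro sum.cong) auto
    then show ?thesis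
      unfolding diagonal_projection_nth[OF lin] tensor_op_axis_nth[OF bounded_clinear_id]
      by (simp add: tensor_op_nth)
  qed
  then have "f \<otimes>\<^sub>o (id :: 's \<Rightarrow> 's) = diagonal_projection (f \<otimes>\<^sub>o id)"
    by (simp add: fun_eq_iff vec_eq_iff)
  with lin show "f \<otimes>\<^sub>o (id :: 's \<Rightarrow> 's) \<in> diagonal_subalgebra"
    by (auto simp: diagonal_subalgebra_def)
qed

lemma diagonal_entries_iff:
  assumes "bounded_clinear f"
  shows "(\<forall>a k. a \<noteq> k \<longrightarrow> f (ket k) $ a = 0) \<longleftrightarrow>
    (\<exists>c. f = (\<lambda>\<phi>. \<Sum>g\<in>UNIV. c g *\<^sub>C ketbra g g \<phi>))"
proof -
  have nth: "(\<Sum>g\<in>UNIV. c g *\<^sub>C ketbra g g \<phi>) $ a = c a * \<phi> $ a" for c \<phi> and a :: 'a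
    by (simp add: ketbra_def ket_nth if_distrib cong: if_cong)
  show ?thesis
  proof
    assume diag: "\<forall>a k. a \<noteq> k \<longrightarrow> f (ket k) $ a = 0"
    have "f \<phi> $ a = f (ket a) $ a * \<phi> $ a" for \<phi> a
    proof -
      have "(\<Sum>k\<in>UNIV. f (ket k) $ a * \<phi> $ k) =
          (\<Sum>k\<in>UNIV. if k = a then f (ket a) $ a * \<phi> $ a else 0)"
        using diag by (intro sum.cong) auto
      then show ?thesis
        by (simp add: apply_nth_ket_expansion[OF assms, of \<phi>])
    qed
    then have "f = (\<lambda>\<phi>. \<Sum>g\<in>UNIV. (f (ket g) $ g) *\<^sub>C ketbra g g \<phi>)"
      unfolding fun_eq_iff vec_eq_iff nth by blast
    then show "\<exists>c. f = (\<lambda>\<phi>. \<Sum>g\<in>UNIV. c g *\<^sub>C ketbra g g \<phi>)"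
      by (rule exI[where x = "\<lambda>g. f (ket g) $ g"])
  next
    assume "\<exists>c. f = (\<lambda>\<phi>. \<Sum>g\<in>UNIV. c g *\<^sub>C ketbra g g \<phi>)"
    then obtain c where "f = (\<lambda>\<phi>. \<Sum>g\<in>UNIV. c g *\<^sub>C ketbra g g \<phi>)"
      by blast
    then have "f (ket k) $ a = c a * ket k $ a" for a k
      by (simp only: nth)
    then show "\<forall>a k. a \<noteq> k \<longrightarrow> f (ket k) $ a = 0"
      by (simp add: ket_nth)
  qed
qed

text \<open>Projective faithfulness is what lets invariance force diagonality. In the other
  direction the criterion for \<open>Y\<close> is applied to the parity swap itself.\<close>

theorem theorem3:
  fixes U :: "'g::{finite,ab_group_add} \<Rightarrow> 's::chilbert_space \<Rightarrow> 's"
    and f :: "(complex, 'g) vec \<Rightarrow> (complex, 'g) vec"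
  assumes "\<exists>g::'g. g \<noteq> 0"
    and "\<exists>\<psi>::'s. \<psi> \<noteq> 0"
    and "unitary_rep U"
    and "bounded_clinear f"
  shows "(projectively_faithful U \<longrightarrow>
        ((\<exists>gi gj Y Z. unitary Y \<and> unitary Z \<and>
          f \<otimes>\<^sub>o id \<in> invariant_subalgebra U gi gj (Y \<otimes>\<^sub>o Z)) \<longleftrightarrow>
        f \<otimes>\<^sub>o (id :: 's \<Rightarrow> 's) \<in> diagonal_subalgebra)) \<and>
    (f \<otimes>\<^sub>o (id :: 's \<Rightarrow> 's) \<in> diagonal_subalgebra \<longleftrightarrow>
        (\<exists>c. f = (\<lambda>\<phi>. \<Sum>g\<in>UNIV. c g *\<^sub>C ketbra g g \<phi>))) \<and>
    (f \<otimes>\<^sub>o (id :: 's \<Rightarrow> 's) \<in> diagonal_subalgebra \<longrightarrow>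
        (\<forall>gi gj Y Z. unitary Y \<and> unitary Z \<longrightarrow>
          (f \<otimes>\<^sub>o id \<in> invariant_subalgebra U gi gj (Y \<otimes>\<^sub>o Z) \<longleftrightarrow>
            conj_by_dag Y f = conj_by (parity_swap gi gj) f)))"
proof (intro conjI impI allI)
  note sub_iff = diagonal_subalgebra_iff[OF assms(4,2)]
  have inv_iff: "f \<otimes>\<^sub>o id \<in> invariant_subalgebra U gi gj (Y \<otimes>\<^sub>o Z) \<longleftrightarrow>
      conj_by_dag Y f = conj_by (parity_swap gi gj) f"
    if "f \<otimes>\<^sub>o (id :: 's \<Rightarrow> 's) \<in> diagonal_subalgebra" "unitary Y" "unitary Z" for gi gj Y Z
    using that sub_iff by (intro diagonal_imp_invariant_iff[OF assms(3,4,2)]) blast+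
  show "f \<otimes>\<^sub>o id \<in> invariant_subalgebra U gi gj (Y \<otimes>\<^sub>o Z) \<longleftrightarrow>
      conj_by_dag Y f = conj_by (parity_swap gi gj) f"
    if "f \<otimes>\<^sub>o (id :: 's \<Rightarrow> 's) \<in> diagonal_subalgebra" "unitary Y \<and> unitary Z" for gi gj Y Z
    using that by (intro inv_iff) auto
  show "f \<otimes>\<^sub>o (id :: 's \<Rightarrow> 's) \<in> diagonal_subalgebra \<longleftrightarrow>
      (\<exists>c. f = (\<lambda>\<phi>. \<Sum>g\<in>UNIV. c g *\<^sub>C ketbra g g \<phi>))"
    using sub_iff diagonal_entries_iff[OF assms(4)] by (rule trans)
  assume faithful: "projectively_faithful U"
  show "(\<exists>gi gj Y Z. unitary Y \<and> unitary Z \<and>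
        f \<otimes>\<^sub>o id \<in> invariant_subalgebra U gi gj (Y \<otimes>\<^sub>o Z)) \<longleftrightarrow>
      f \<otimes>\<^sub>o (id :: 's \<Rightarrow> 's) \<in> diagonal_subalgebra"
  proof
    assume "\<exists>gi gj Y Z. unitary Y \<and> unitary Z \<and>
      f \<otimes>\<^sub>o id \<in> invariant_subalgebra U gi gj (Y \<otimes>\<^sub>o Z)"
    then show "f \<otimes>\<^sub>o (id :: 's \<Rightarrow> 's) \<in> diagonal_subalgebra"
      unfolding sub_iff using invariant_imp_diagonal[OF assms(3,4) faithful] by blast
  next
    assume diag: "f \<otimes>\<^sub>o (id :: 's \<Rightarrow> 's) \<in> diagonal_subalgebra"
    \<comment> \<open>The parity swap is its own adjoint, so \<open>Y = parity_swap 0 0\<close>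
      meets the criterion at orientations \<open>0\<close> and \<open>0\<close>.\<close>
    have "conj_by_dag (parity_swap 0 0) f = conj_by (parity_swap 0 0) f"
      by (simp add: conj_by_def conj_by_dag_def cadjoint_parity_swap)
    then have "f \<otimes>\<^sub>o id \<in> invariant_subalgebra U 0 0 (parity_swap 0 0 \<otimes>\<^sub>o id)"
      using inv_iff[OF diag unitary_parity_swap unitary_id] by blast
    then show "\<exists>gi gj Y Z. unitary Y \<and> unitary Z \<and>
        f \<otimes>\<^sub>o id \<in> invariant_subalgebra U gi gj (Y \<otimes>\<^sub>o Z)"
      using unitary_parity_swap unitary_id by blast
  qed
qed

end
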